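(* Let $\Gamma$ be a countable directed graph. Then (i) there exists an idempotent endomorphism $f$ of the countable universal directed graph $D$ such that $\operatorname{im} f\cong\Gamma$ if and only if $\Gamma$ is algebraically closed; (ii) if $\Gamma$ is algebraically closed, there are $2^{\aleph_0}$ idempotent endomorphisms $f$ of $D$ such that $\operatorname{im} f\cong\Gamma$.
   Context: A directed graph is a pair $(V,E)$ with $E$ an irreflexive binary relation on the non-empty set $V$. A directed graph $(V,E)$ is algebraically closed if for every finite $A\subseteq V$ there is a vertex $v$ with $(u,v),(v,u)\in E$ for all $u\in A$. The countable universal directed graph $D$ is the Fraïssé limit of the finite directed graphs. For an endomorphism $f$ of $D=(V,E)$, $\operatorname{im} f=(Vf,Ef)$. *)

theory Defs
  imports "HOL-Library.FuncSet" "HOL-Library.Countable_Set" "HOL-Library.Equipollence"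
begin

type_synonym 'a dgraph = "'a set \<times> 'a rel"

abbreviation verts :: "'a dgraph \<Rightarrow> 'a set" where
  "verts G \<equiv> fst G"

abbreviation edges :: "'a dgraph \<Rightarrow> 'a rel" where
  "edges G \<equiv> snd G"

definition directed_graph :: "'a dgraph \<Rightarrow> bool" where
  "directed_graph G \<longleftrightarrow> verts G \<noteq> {} \<and> edges G \<subseteq> verts G \<times> verts G \<and> irrefl (edges G)"

definition algebraically_closed :: "'a dgraph \<Rightarrow> bool" where
  "algebraically_closed G \<longleftrightarrow>
    (\<forall>A. finite A \<and> A \<subseteq> verts G \<longrightarrow>
      (\<exists>v\<in>verts G. \<forall>u\<in>A. (u, v) \<in> edges G \<and> (v, u) \<in> edges G))"

definition embedding :: "'a dgraph \<Rightarrow> 'b dgraph \<Rightarrow> ('a \<Rightarrow> 'b) \<Rightarrow> bool" where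
  "embedding G H h \<longleftrightarrow> h \<in> verts G \<rightarrow> verts H \<and> inj_on h (verts G) \<and>
    (\<forall>u\<in>verts G. \<forall>v\<in>verts G. (u, v) \<in> edges G \<longleftrightarrow> (h u, h v) \<in> edges H)"

definition isomorphism :: "'a dgraph \<Rightarrow> 'b dgraph \<Rightarrow> ('a \<Rightarrow> 'b) \<Rightarrow> bool" where
  "isomorphism G H h \<longleftrightarrow> bij_betw h (verts G) (verts H) \<and>
    (\<forall>u\<in>verts G. \<forall>v\<in>verts G. (u, v) \<in> edges G \<longleftrightarrow> (h u, h v) \<in> edges H)"

definition isomorphic :: "'a dgraph \<Rightarrow> 'b dgraph \<Rightarrow> bool" (infix "\<cong>" 50) where
  "G \<cong> H \<longleftrightarrow> (\<exists>h. isomorphism G H h)"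

definition induced_subgraph :: "'a dgraph \<Rightarrow> 'a set \<Rightarrow> 'a dgraph" where
  "induced_subgraph G A = (A, edges G \<inter> A \<times> A)"

definition homogeneous :: "'a dgraph \<Rightarrow> bool" where
  "homogeneous G \<longleftrightarrow>
    (\<forall>A B h. finite A \<and> A \<subseteq> verts G \<and> B \<subseteq> verts G \<and>
        isomorphism (induced_subgraph G A) (induced_subgraph G B) h \<longrightarrow>
      (\<exists>g. isomorphism G G g \<and> (\<forall>x\<in>A. g x = h x)))"

text \<open>Every finite directed graph has an isomorphic copy with vertices in \<^typ>\<open>nat\<close>, so
  isomorphism-closed classes of finite directed graphs are represented by sets of graphs on
  \<^typ>\<open>nat\<close>.\<close>

definition finite_directed_graphs :: "nat dgraph set" where
  "finite_directed_graphs = {F. directed_graph F \<and> finite (verts F)}"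

definition age :: "'a dgraph \<Rightarrow> nat dgraph set" where
  "age G = {F. directed_graph F \<and> finite (verts F) \<and> (\<exists>h. embedding F G h)}"

definition fraisse_limit :: "nat dgraph set \<Rightarrow> 'a dgraph \<Rightarrow> bool" where
  "fraisse_limit K G \<longleftrightarrow>
    directed_graph G \<and> countable (verts G) \<and> homogeneous G \<and> age G = K"

text \<open>Endomorphisms are extensional (\<^const>\<open>undefined\<close> outside the vertex set), so that
  distinct HOL functions are distinct endomorphisms; this matters when they are counted.\<close>

definition endomorphism :: "'a dgraph \<Rightarrow> ('a \<Rightarrow> 'a) \<Rightarrow> bool" where
  "endomorphism G f \<longleftrightarrow> f \<in> verts G \<rightarrow>\<^sub>E verts G \<and>
    (\<forall>u v. (u, v) \<in> edges G \<longrightarrow> (f u, f v) \<in> edges G)"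

definition idempotent_endomorphism :: "'a dgraph \<Rightarrow> ('a \<Rightarrow> 'a) \<Rightarrow> bool" where
  "idempotent_endomorphism G f \<longleftrightarrow>
    endomorphism G f \<and> (\<forall>x\<in>verts G. f (f x) = f x)"

definition im :: "'a dgraph \<Rightarrow> ('a \<Rightarrow> 'a) \<Rightarrow> 'a dgraph" where
  "im G f = (f ` verts G, map_prod f f ` edges G)"

end

theory Submission
  imports Defs
begin

text \<open>
  The graph \<open>D\<close> has the one-point extension property. Hence the vertices of an algebraically
  closed \<open>\<Gamma>\<close> can be embedded into \<open>D\<close> one at a time so that every vertex of \<open>D\<close> off the copy of
  \<open>\<Gamma>\<close> is adjacent to only finitely many vertices of that copy. The remaining vertices of \<open>D\<close> are
  then retracted onto the copy in turn: at each stage only finitely many vertices constrain the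
  image, and algebraic closure supplies two distinct admissible images. Infinitely many
  independent binary choices give continuum many retractions. Conversely, a retraction maps a
  common neighbour in \<open>D\<close> of a finite part of its image to a common neighbour in the image.
\<close>

section \<open>One-point extensions in the universal directed graph\<close>

text \<open>A copy of \<open>A\<close> with one new vertex joined as prescribed is a finite directed
  graph, so it embeds in \<open>D\<close>. Homogeneity then moves \<open>A\<close> onto its embedded
  copy by an automorphism, and the new vertex is pulled back.\<close>

lemma one_point_extension:
  fixes D :: "'b dgraph"
  assumes D: "fraisse_limit finite_directed_graphs D"
    and A: "finite A" "A \<subseteq> verts D" and "P \<subseteq> A" "Q \<subseteq> A"
  shows "\<exists>v\<in>verts D - A. \<forall>a\<in>A.
    ((v, a) \<in> edges D \<longleftrightarrow> a \<in> P) \<and> ((a, v) \<in> edges D \<longleftrightarrow> a \<in> Q)"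
proof -
  from D have dg: "directed_graph D" and hom: "homogeneous D"
    and age: "age D = finite_directed_graphs"
    by (auto simp: fraisse_limit_def)
  obtain k :: "'b \<Rightarrow> nat" where k: "inj_on k A"
    using finite_imp_inj_to_nat_seg[OF A(1)] by blast
  obtain m where m: "m \<notin> k ` A"
    using ex_new_if_finite[of "k ` A"] A(1) by auto
  \<comment> \<open>The new vertex \<open>m\<close> carries the required adjacencies and keeps
    \<open>F\<close> nonempty even when \<open>A\<close> is empty.\<close>
  define F :: "nat dgraph" where "F = (insert m (k ` A),
    {(k a, k b) | a b. a \<in> A \<and> b \<in> A \<and> (a, b) \<in> edges D} \<union>
    {(m, k a) | a. a \<in> P} \<union> {(k a, m) | a. a \<in> Q})"
  have "F \<in> age D"
    unfolding age finite_directed_graphs_def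
    using dg m A k \<open>P \<subseteq> A\<close> \<open>Q \<subseteq> A\<close>
    by (auto simp: F_def directed_graph_def irrefl_def inj_on_eq_iff dest: inj_onD)
  then obtain h where h: "embedding F D h"
    by (auto simp: age_def)
  have keq: "k a = k b \<longleftrightarrow> a = b" if "a \<in> A" "b \<in> A" for a b
    using inj_on_eq_iff[OF k] that by blast
  have km: "k a \<noteq> m" "m \<noteq> k a" if "a \<in> A" for a
    using m that by auto
  have PQ: "a \<in> A" if "a \<in> P \<or> a \<in> Q" for a
    using that \<open>P \<subseteq> A\<close> \<open>Q \<subseteq> A\<close> by auto
  have kk: "(k a, k b) \<in> edges F \<longleftrightarrow> (a, b) \<in> edges D" if "a \<in> A" "b \<in> A" for a b
    using that by (auto simp: F_def keq km PQ)
  have mk: "(m, k a) \<in> edges F \<longleftrightarrow> a \<in> P" "(k a, m) \<in> edges F \<longleftrightarrow> a \<in> Q" if "a \<in> A" for a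
    using that by (auto simp: F_def keq km PQ)
  have vF: "verts F = insert m (k ` A)"
    by (simp add: F_def)
  have hV: "h i \<in> verts D" if "i \<in> verts F" for i
    using h that by (auto simp: embedding_def)
  have hinj: "inj_on h (verts F)"
    using h by (simp add: embedding_def)
  have hE: "(h i, h j) \<in> edges D \<longleftrightarrow> (i, j) \<in> edges F" if "i \<in> verts F" "j \<in> verts F" for i j
    using h that by (auto simp: embedding_def)
  have "inj_on (h \<circ> k) A"
    using comp_inj_on[OF k inj_on_subset[OF hinj]] vF by blast
  then have "isomorphism (induced_subgraph D A) (induced_subgraph D ((h \<circ> k) ` A)) (h \<circ> k)"
    by (auto simp: isomorphism_def induced_subgraph_def bij_betw_def hE vF kk)
  moreover have "(h \<circ> k) ` A \<subseteq> verts D"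
    using hV vF by auto
  ultimately obtain g where g: "isomorphism D D g" and gh: "\<forall>x\<in>A. g x = (h \<circ> k) x"
    using hom[unfolded homogeneous_def, rule_format, of A "(h \<circ> k) ` A" "h \<circ> k"] A by auto
  have "h m \<in> g ` verts D"
    using g hV vF by (auto simp: isomorphism_def bij_betw_def)
  then obtain v where v: "v \<in> verts D" "g v = h m"
    by auto
  have gE: "(a, b) \<in> edges D \<longleftrightarrow> (g a, g b) \<in> edges D" if "a \<in> verts D" "b \<in> verts D" for a b
    using g that by (auto simp: isomorphism_def)
  have "v \<notin> A"
  proof
    assume "v \<in> A"
    with gh v have "h (k v) = h m" by simp
    with inj_onD[OF hinj] \<open>v \<in> A\<close> vF have "k v = m" by blast
    with km \<open>v \<in> A\<close> show False by blast
  qed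
  moreover have "((v, a) \<in> edges D \<longleftrightarrow> a \<in> P) \<and> ((a, v) \<in> edges D \<longleftrightarrow> a \<in> Q)"
    if "a \<in> A" for a
  proof -
    have "a \<in> verts D" "g a = h (k a)" "k a \<in> verts F" "m \<in> verts F"
      using that A gh vF by auto
    then show ?thesis
      using gE[of v a] gE[of a v] v hE mk[OF that] by simp
  qed
  ultimately show ?thesis
    using v(1) by blast
qed

section \<open>Algebraic closure and its transfer\<close>

text \<open>Closure applied to a finite full vertex set would force a loop. Infinitude later allows
  \<Gamma> to be indexed bijectively by all natural numbers.\<close>

lemma algebraically_closed_infinite:
  assumes "directed_graph G" "algebraically_closed G"
  shows "infinite (verts G)"
proof
  assume "finite (verts G)"
  with assms(2) obtain v where "v \<in> verts G" "(v, v) \<in> edges G"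
    unfolding algebraically_closed_def by blast
  with assms(1) show False
    by (auto simp: directed_graph_def irrefl_def)
qed

lemma algebraically_closed_fraisse_limit:
  assumes "fraisse_limit finite_directed_graphs D"
  shows "algebraically_closed D"
  unfolding algebraically_closed_def
proof (intro allI impI)
  fix A assume A: "finite A \<and> A \<subseteq> verts D"
  then show "\<exists>v\<in>verts D. \<forall>u\<in>A. (u, v) \<in> edges D \<and> (v, u) \<in> edges D"
    using one_point_extension[OF assms, of A A A] by auto
qed

lemma algebraically_closed_im:
  assumes G: "algebraically_closed G" and f: "idempotent_endomorphism G f"
  shows "algebraically_closed (im G f)"
  unfolding algebraically_closed_def
proof (intro allI impI)
  fix A assume A: "finite A \<and> A \<subseteq> verts (im G f)"
  have fV: "f x \<in> verts G" "f (f x) = f x" if "x \<in> verts G" for x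
    using f that by (auto simp: idempotent_endomorphism_def endomorphism_def)
  from A have AV: "A \<subseteq> verts G" and fA: "\<And>a. a \<in> A \<Longrightarrow> f a = a"
    using fV by (auto simp: im_def)
  obtain v where v: "v \<in> verts G" "\<And>a. a \<in> A \<Longrightarrow> (a, v) \<in> edges G \<and> (v, a) \<in> edges G"
    using G[unfolded algebraically_closed_def, rule_format, of A] A AV by auto
  \<comment> \<open>Edges of \<open>im G f\<close> are images of edges of \<open>G\<close>. Since
    \<open>f\<close> fixes \<open>a\<close>, the edges between \<open>a\<close> and \<open>v\<close>
    are sent to edges between \<open>a\<close> and \<open>f v\<close>.\<close>
  have "(a, f v) \<in> edges (im G f) \<and> (f v, a) \<in> edges (im G f)" if "a \<in> A" for a
    using v(2)[OF that] fA[OF that]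
    by (metis im_def map_prod_imageI snd_conv)
  then show "\<exists>v\<in>verts (im G f). \<forall>u\<in>A. (u, v) \<in> edges (im G f) \<and> (v, u) \<in> edges (im G f)"
    using v(1) by (auto simp: im_def)
qed

lemma algebraically_closed_isomorphic:
  assumes "G \<cong> H" "algebraically_closed G"
  shows "algebraically_closed H"
  unfolding algebraically_closed_def
proof (intro allI impI)
  fix A assume A: "finite A \<and> A \<subseteq> verts H"
  obtain h where h: "isomorphism G H h"
    using assms(1) by (auto simp: isomorphic_def)
  then have "h ` verts G = verts H"
    by (auto simp: isomorphism_def bij_betw_def)
  with A obtain B where B: "B \<subseteq> verts G" "finite B" "A = h ` B"
    using finite_subset_image by metis
  then obtain v where v: "v \<in> verts G" "\<forall>u\<in>B. (u, v) \<in> edges G \<and> (v, u) \<in> edges G"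
    using assms(2) unfolding algebraically_closed_def by blast
  have "\<forall>u\<in>A. (u, h v) \<in> edges H \<and> (h v, u) \<in> edges H"
    using v B h unfolding isomorphism_def by blast
  moreover have "h v \<in> verts H"
    using \<open>h ` verts G = verts H\<close> v by auto
  ultimately show "\<exists>v\<in>verts H. \<forall>u\<in>A. (u, v) \<in> edges H \<and> (v, u) \<in> edges H"
    by blast
qed

section \<open>Sparse copies in the universal directed graph\<close>

text \<open>The copy is built greedily along an enumeration \<open>d\<close> of \<open>D\<close>:
  each new vertex avoids, and is not joined to, the vertices listed so far that have not been used.
  Sparseness will leave finitely many constraints on the image of each remaining vertex, and the
  infinite complement will supply infinitely many choices.\<close>

lemma sparse_embedding:
  fixes D :: "'b dgraph" and R :: "nat rel"
  assumes D: "fraisse_limit finite_directed_graphs D" and "irrefl R"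
  obtains x :: "nat \<Rightarrow> 'b" where "range x \<subseteq> verts D" "inj x"
    "\<And>i j. (x i, x j) \<in> edges D \<longleftrightarrow> (i, j) \<in> R"
    "\<And>u. u \<in> verts D - range x \<Longrightarrow> finite {i. (u, x i) \<in> edges D \<or> (x i, u) \<in> edges D}"
    "infinite (verts D - range x)"
proof -
  from D have dg: "directed_graph D" and "countable (verts D)"
    by (auto simp: fraisse_limit_def)
  have "verts D \<noteq> {}"
    using dg by (simp add: directed_graph_def)
  then obtain d :: "nat \<Rightarrow> 'b" where d: "range d = verts D"
    by (rule that[OF range_from_nat_into[OF _ \<open>countable (verts D)\<close>]])
  define P where "P x n v \<longleftrightarrow> v \<in> verts D \<and> v \<notin> x ` {..<n} \<union> d ` {..n} \<and>
      (\<forall>i<n. ((v, x i) \<in> edges D \<longleftrightarrow> (n, i) \<in> R) \<and> ((x i, v) \<in> edges D \<longleftrightarrow> (i, n) \<in> R)) \<and>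
      (\<forall>u\<in>d ` {..n} - x ` {..<n}. (v, u) \<notin> edges D \<and> (u, v) \<notin> edges D)" for x n v
  have "\<exists>x. \<forall>n. P x n (x n)"
  proof (rule dependent_wellorder_choice)
    fix v :: 'b and x y :: "nat \<Rightarrow> 'b" and n
    assume eq: "\<And>i. i < n \<Longrightarrow> x i = y i"
    then have "x ` {..<n} = y ` {..<n}"
      by auto
    with eq show "P x n v = P y n v"
      by (simp add: P_def)
  next
    fix n and x :: "nat \<Rightarrow> 'b"
    assume IH: "\<And>i. i < n \<Longrightarrow> P x i (x i)"
    have xV: "x ` {..<n} \<subseteq> verts D"
      using IH by (auto simp: P_def)
    have ne: "x i \<noteq> x j" if "i < j" "j < n" for i j
      using IH[of j] that unfolding P_def by (metis UnI1 imageI lessThan_iff)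
    have xi: "x i = x j \<longleftrightarrow> i = j" if "i < n" "j < n" for i j
      using ne[of i j] ne[of j i] that by (cases i j rule: linorder_cases) auto
    define A where "A = x ` {..<n} \<union> d ` {..n}"
    \<comment> \<open>Only earlier values of \<open>x\<close> enter these sets, so the listed
      vertices that are not among them receive no edges to or from \<open>v\<close>.\<close>
    define Out In where "Out = x ` {i. i < n \<and> (n, i) \<in> R}"
      and "In = x ` {i. i < n \<and> (i, n) \<in> R}"
    have "finite A" "A \<subseteq> verts D" "Out \<subseteq> A" "In \<subseteq> A"
      using xV d by (auto simp: A_def Out_def In_def)
    from one_point_extension[OF D this] obtain v where v: "v \<in> verts D" "v \<notin> A" and
      vE: "\<And>a. a \<in> A \<Longrightarrow>
        ((v, a) \<in> edges D \<longleftrightarrow> a \<in> Out) \<and> ((a, v) \<in> edges D \<longleftrightarrow> a \<in> In)"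
      by auto
    have "P x n v"
      unfolding P_def
    proof (intro conjI allI impI ballI)
      fix i assume "i < n"
      then show "((v, x i) \<in> edges D) = ((n, i) \<in> R)" "((x i, v) \<in> edges D) = ((i, n) \<in> R)"
        using vE[of "x i"] xi by (auto simp: A_def Out_def In_def)
    next
      fix u assume "u \<in> d ` {..n} - x ` {..<n}"
      then show "(v, u) \<notin> edges D" "(u, v) \<notin> edges D"
        using vE[of u] by (auto simp: A_def Out_def In_def)
    qed (use v in \<open>auto simp: A_def\<close>)
    then show "\<exists>v. P x n v" ..
  qed
  then obtain x where x: "\<And>n. P x n (x n)"
    by blast
  have xV: "range x \<subseteq> verts D"
    using x by (auto simp: P_def)
  have ne: "x i \<noteq> x j" if "i < j" for i j
    using x[of j] that unfolding P_def by (metis UnI1 imageI lessThan_iff)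
  have "inj x"
    using ne by (metis injI linorder_neqE_nat)
  have irr: "(x i, x i) \<notin> edges D" "(i, i) \<notin> R" for i
    using dg \<open>irrefl R\<close> by (auto simp: directed_graph_def irrefl_def)
  have xE: "(x i, x j) \<in> edges D \<longleftrightarrow> (i, j) \<in> R" for i j
    using x[of i] x[of j] irr by (cases i j rule: linorder_cases) (auto simp: P_def)
  have fin: "finite {i. (u, x i) \<in> edges D \<or> (x i, u) \<in> edges D}"
    if u: "u \<in> verts D - range x" for u
  proof -
    obtain m where "u = d m"
      using u d by (metis DiffD1 imageE)
    have "{i. (u, x i) \<in> edges D \<or> (x i, u) \<in> edges D} \<subseteq> {..<m}"
    proof clarsimp
      fix i assume *: "(u, x i) \<in> edges D \<or> (x i, u) \<in> edges D"
      show "i < m"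
      proof (rule ccontr)
        assume "\<not> i < m"
        then have "u \<in> d ` {..i} - x ` {..<i}"
          using \<open>u = d m\<close> u by auto
        with * x[of i] show False
          unfolding P_def by blast
      qed
    qed
    then show ?thesis
      using finite_subset by blast
  qed
  \<comment> \<open>The vertex \<open>d 0\<close> is already listed at stage 0, so it is never
    chosen.\<close>
  have "d 0 \<noteq> x n" for n
    using x[of n] unfolding P_def by (metis UnI2 atMost_iff imageI le0)
  then have d0: "d 0 \<in> verts D - range x"
    using d by auto
  \<comment> \<open>If the complement of \<open>range x\<close> were finite, the extension property
    would give a vertex outside it and outside \<open>N\<close> with an edge to \<open>d 0\<close>.
    Such a vertex is some \<open>x i\<close> joined to \<open>d 0\<close>, hence in \<open>N\<close>
    after all.\<close>
  define N where "N = x ` {i. (d 0, x i) \<in> edges D \<or> (x i, d 0) \<in> edges D}"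
  have "infinite (verts D - range x)"
  proof
    assume *: "finite (verts D - range x)"
    have "finite N"
      unfolding N_def using fin[OF d0] by simp
    then have "finite (N \<union> (verts D - range x))" "N \<union> (verts D - range x) \<subseteq> verts D"
      "{d 0} \<subseteq> N \<union> (verts D - range x)" "{} \<subseteq> N \<union> (verts D - range x)"
      using * d0 xV by (auto simp: N_def)
    from one_point_extension[OF D this] obtain v
      where "v \<in> verts D" "v \<notin> N \<union> (verts D - range x)" "(v, d 0) \<in> edges D"
      using d0 by auto
    then show False
      by (auto simp: N_def)
  qed
  with xV \<open>inj x\<close> xE fin show ?thesis
    by (rule that)
qed

section \<open>Retractions onto a sparse copy\<close>

text \<open>A set \<open>s\<close> of natural numbers encodes a retraction \<open>f s\<close>:
  membership of \<open>n\<close> in \<open>s\<close> selects one of two admissible images for the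
  remaining vertex \<open>w n\<close>.\<close>

lemma nat_set_lepoll_retractions:
  fixes D :: "'b dgraph" and R :: "nat rel"
  assumes D: "directed_graph D" "countable (verts D)"
    and R: "irrefl R" "algebraically_closed (UNIV, R)"
    and x: "range x \<subseteq> verts D" "inj x" "\<And>i j. (x i, x j) \<in> edges D \<longleftrightarrow> (i, j) \<in> R"
    and fin: "\<And>u. u \<in> verts D - range x \<Longrightarrow>
      finite {i. (u, x i) \<in> edges D \<or> (x i, u) \<in> edges D}"
    and inf: "infinite (verts D - range x)"
  shows "(UNIV :: nat set set) \<lesssim>
    {f. idempotent_endomorphism D f \<and> im D f = (range x, map_prod x x ` R)}"
proof -
  define W where "W = verts D - range x"
  have W: "countable W" "infinite W"
    using D inf by (auto simp: W_def)
  define w where "w = from_nat_into W"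
  have w: "bij_betw w UNIV W"
    unfolding w_def using W by (rule bij_betw_from_nat_into)
  define adj where "adj F c \<longleftrightarrow> (\<forall>i\<in>F. (i, c) \<in> R \<and> (c, i) \<in> R)" for F c
  have "\<exists>c. adj F c" if "finite F" for F
    using R(2) that by (auto simp: algebraically_closed_def adj_def)
  then obtain c0 where c0: "\<And>F. finite F \<Longrightarrow> adj F (c0 F)"
    by metis
  \<comment> \<open>Including \<open>c0 F\<close> among the vertices to be joined makes
    \<open>c1 F\<close> a neighbour of it, hence different from it by irreflexivity.\<close>
  define c1 where "c1 F = c0 (insert (c0 F) F)" for F
  have c1: "adj F (c1 F)" "c1 F \<noteq> c0 F" if "finite F" for F
    using c0[of "insert (c0 F) F"] that R(1) by (auto simp: adj_def c1_def irrefl_def)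
  define N where "N n = {i. (w n, x i) \<in> edges D \<or> (x i, w n) \<in> edges D}" for n
  have finN: "finite (N n)" for n
    using fin w unfolding N_def W_def bij_betw_def by blast
  \<comment> \<open>The index \<open>g s n\<close> is joined in both directions to all earlier
    images and to all indices in \<open>N n\<close>, so every possible edge at \<open>w n\<close> is
    respected without inspecting its direction.\<close>
  have "\<exists>g. \<forall>n. g n = (if n \<in> s then c1 else c0) (g ` {..<n} \<union> N n)" for s
  proof (rule dependent_wellorder_choice)
    fix r n and g h :: "nat \<Rightarrow> nat"
    assume "\<And>i. i < n \<Longrightarrow> g i = h i"
    then have "g ` {..<n} = h ` {..<n}"
      by auto
    then show "(r = (if n \<in> s then c1 else c0) (g ` {..<n} \<union> N n)) =
        (r = (if n \<in> s then c1 else c0) (h ` {..<n} \<union> N n))"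
      by simp
  qed blast
  then obtain g where g: "\<And>s n. g s n = (if n \<in> s then c1 else c0) (g s ` {..<n} \<union> N n)"
    by metis
  have g_adj: "adj (g s ` {..<n} \<union> N n) (g s n)" for s n
    using g[of s n] c0 c1(1) finN by auto
  \<comment> \<open>Equal sequences present the same finite set at stage \<open>n\<close>, where the
    two choices differ. The value taken therefore reveals whether \<open>n\<close> belongs to the
    set.\<close>
  have g_inj: "s = t" if "g s = g t" for s t
  proof (rule set_eqI)
    fix n
    have "c1 (g t ` {..<n} \<union> N n) \<noteq> c0 (g t ` {..<n} \<union> N n)"
      using c1(2) finN by simp
    then show "n \<in> s \<longleftrightarrow> n \<in> t"
      using g[of s n] g[of t n] that by (auto split: if_splits)
  qed
  \<comment> \<open>The second branch fixes the copy pointwise; \<open>undefined\<close> outside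
    \<open>verts D\<close> gives the extensionality demanded of endomorphisms.\<close>
  define f where "f s v = (if v \<in> W then x (g s (inv w v)) else if v \<in> verts D then v else undefined)"
    for s v
  have fw: "f s (w n) = x (g s n)" for s n
    using w by (auto simp: f_def bij_betw_def inv_f_f)
  have fx: "f s (x i) = x i" for s i
    using x(1) by (auto simp: f_def W_def)
  have cases_V: "(\<exists>i. v = x i) \<or> (\<exists>n. v = w n)" if "v \<in> verts D" for v
  proof (cases "v \<in> range x")
    case False
    with that have "v \<in> range w"
      using w by (auto simp: W_def bij_betw_def)
    then show ?thesis by blast
  qed auto
  \<comment> \<open>Landing in the edges of the copy yields both the endomorphism property and one
    inclusion for the edge set of the image.\<close>
  have fE: "(f s u, f s v) \<in> map_prod x x ` R" if E: "(u, v) \<in> edges D" for s u v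
  proof -
    have "u \<in> verts D" "v \<in> verts D"
      using D(1) that by (auto simp: directed_graph_def)
    then consider (xx) i j where "u = x i" "v = x j" | (xw) i n where "u = x i" "v = w n"
      | (wx) n i where "u = w n" "v = x i" | (ww) m n where "u = w m" "v = w n"
      using cases_V by metis
    then show ?thesis
    proof cases
      case xx
      then show ?thesis
        using E x(3) by (auto simp: fx)
    next
      case xw
      then have "(i, g s n) \<in> R"
        using g_adj[of s n] E by (auto simp: adj_def N_def)
      then show ?thesis
        using xw by (auto simp: fx fw)
    next
      case wx
      then have "(g s n, i) \<in> R"
        using g_adj[of s n] E by (auto simp: adj_def N_def)
      then show ?thesis
        using wx by (auto simp: fx fw)
    next
      case ww
      then have "m \<noteq> n"
        using E D(1) by (auto simp: directed_graph_def irrefl_def)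
      \<comment> \<open>Whichever of the two vertices comes later had its image chosen joined in
        both directions to the earlier image.\<close>
      then have "(g s m, g s n) \<in> R"
        using g_adj[of s n] g_adj[of s m] by (cases m n rule: linorder_cases) (auto simp: adj_def)
      then show ?thesis
        using ww by (auto simp: fw)
    qed
  qed
  have f_range: "f s v \<in> range x" if "v \<in> verts D" for s v
    using cases_V[OF that] by (auto simp: fx fw)
  have "idempotent_endomorphism D (f s)" for s
    unfolding idempotent_endomorphism_def endomorphism_def
  proof (intro conjI allI impI ballI PiE_I)
    fix u v assume "(u, v) \<in> edges D"
    from fE[OF this, of s] show "(f s u, f s v) \<in> edges D"
      using x(3) by auto
  next
    fix v assume "v \<in> verts D"
    with f_range x(1) show "f s v \<in> verts D" by blast
  next
    fix v assume "v \<in> verts D"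
    from f_range[OF this, of s] show "f s (f s v) = f s v"
      by (metis fx imageE)
  qed (simp add: f_def W_def)
  moreover have "im D (f s) = (range x, map_prod x x ` R)" for s
  proof -
    have "x i \<in> f s ` verts D" for i
      using x(1) fx[of s i] by (metis image_eqI range_subsetD)
    then have "f s ` verts D = range x"
      using f_range by blast
    moreover have "map_prod (f s) (f s) ` edges D = map_prod x x ` R"
    proof
      show "map_prod (f s) (f s) ` edges D \<subseteq> map_prod x x ` R"
        using fE by auto
      show "map_prod x x ` R \<subseteq> map_prod (f s) (f s) ` edges D"
      proof clarsimp
        fix i j assume "(i, j) \<in> R"
        then have "(x i, x j) \<in> edges D"
          by (simp add: x(3))
        from map_prod_imageI[OF this, of "f s" "f s"]
        show "(x i, x j) \<in> map_prod (f s) (f s) ` edges D"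
          by (simp add: fx)
      qed
    qed
    ultimately show ?thesis
      by (simp add: im_def)
  qed
  moreover have "inj f"
  proof (rule injI)
    fix s t assume "f s = f t"
    then have "x (g s n) = x (g t n)" for n
      by (metis fw)
    then have "g s = g t"
      using x(2) by (auto simp: inj_eq)
    then show "s = t"
      by (rule g_inj)
  qed
  ultimately show ?thesis
    unfolding lepoll_def by (intro exI[of _ f]) auto
qed

section \<open>Counting the idempotents\<close>

text \<open>An extensional map is determined by its graph, a subset of the countable set
  \<open>V \<times> V\<close>, which can be coded as a set of natural numbers.\<close>

lemma endomorphisms_lepoll_nat_set:
  assumes "countable (verts G)"
  shows "{f. endomorphism G f} \<lesssim> (UNIV :: nat set set)"
proof -
  define V where "V = verts G"
  have c: "inj_on (to_nat_on (V \<times> V)) (V \<times> V)"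
    using assms by (intro inj_on_to_nat_on) (simp add: V_def)
  define F where "F f = to_nat_on (V \<times> V) ` (\<lambda>v. (v, f v)) ` V" for f
  have "inj_on F {f. endomorphism G f}"
  proof (rule inj_onI)
    fix f g assume fg: "f \<in> {f. endomorphism G f}" "g \<in> {f. endomorphism G f}" "F f = F g"
    then have fgV: "f \<in> V \<rightarrow>\<^sub>E V" "g \<in> V \<rightarrow>\<^sub>E V"
      by (auto simp: endomorphism_def V_def)
    then have "(\<lambda>v. (v, f v)) ` V \<subseteq> V \<times> V" "(\<lambda>v. (v, g v)) ` V \<subseteq> V \<times> V"
      by auto
    with c fg(3) have "(\<lambda>v. (v, f v)) ` V = (\<lambda>v. (v, g v)) ` V"
      unfolding F_def by (simp add: inj_on_image_eq_iff)
    then have "f v = g v" if "v \<in> V" for v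
      using that by auto
    with fgV show "f = g"
      by (rule PiE_ext)
  qed
  then show ?thesis
    unfolding lepoll_def by blast
qed

text \<open>An enumeration \<open>b\<close> transports \<Gamma> to a relation \<open>R\<close> on
  the natural numbers, where the sparse copy and its retractions are available.\<close>

lemma nat_set_lepoll_idempotents:
  fixes \<Gamma> :: "'a dgraph" and D :: "'b dgraph"
  assumes \<Gamma>: "directed_graph \<Gamma>" "countable (verts \<Gamma>)" "algebraically_closed \<Gamma>"
    and D: "fraisse_limit finite_directed_graphs D"
  shows "(UNIV :: nat set set) \<lesssim> {f. idempotent_endomorphism D f \<and> im D f \<cong> \<Gamma>}"
proof -
  obtain b :: "nat \<Rightarrow> 'a" where b: "bij_betw b UNIV (verts \<Gamma>)"
    by (rule that[OF bij_betw_from_nat_into[OF \<Gamma>(2) algebraically_closed_infinite[OF \<Gamma>(1,3)]]])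
  then have "inj b"
    by (simp add: bij_betw_def)
  define R where "R = {(i, j). (b i, b j) \<in> edges \<Gamma>}"
  have R: "irrefl R"
    using \<Gamma>(1) by (auto simp: R_def irrefl_def directed_graph_def)
  have "\<Gamma> \<cong> (UNIV, R)"
    unfolding isomorphic_def isomorphism_def
  proof (intro exI conjI ballI)
    show "bij_betw (inv b) (verts \<Gamma>) (verts (UNIV, R))"
      using b bij_betw_inv_into by fastforce
    fix u v assume "u \<in> verts \<Gamma>" "v \<in> verts \<Gamma>"
    then obtain i j where "u = b i" "v = b j"
      by (metis b bij_betw_def imageE)
    then show "((u, v) \<in> edges \<Gamma>) = ((inv b u, inv b v) \<in> edges (UNIV, R))"
      using \<open>inj b\<close> by (simp add: R_def)
  qed
  then have ac: "algebraically_closed (UNIV, R)"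
    using \<Gamma>(3) by (rule algebraically_closed_isomorphic)
  obtain x where x: "range x \<subseteq> verts D" "inj x" "\<And>i j. (x i, x j) \<in> edges D \<longleftrightarrow> (i, j) \<in> R"
    "\<And>u. u \<in> verts D - range x \<Longrightarrow> finite {i. (u, x i) \<in> edges D \<or> (x i, u) \<in> edges D}"
    "infinite (verts D - range x)"
    using sparse_embedding[OF D R] by blast
  have "directed_graph D" "countable (verts D)"
    using D by (auto simp: fraisse_limit_def)
  from nat_set_lepoll_retractions[OF this R ac x]
  have "(UNIV :: nat set set) \<lesssim>
    {f. idempotent_endomorphism D f \<and> im D f = (range x, map_prod x x ` R)}" .
  moreover have "(range x, map_prod x x ` R) \<cong> \<Gamma>"
    unfolding isomorphic_def isomorphism_def
  proof (intro exI conjI ballI)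
    \<comment> \<open>The isomorphism passes from a vertex of the copy to its index and then to the
      vertex of \<Gamma> with that index.\<close>
    have "bij_betw (inv x) (range x) UNIV"
      using x(2) by (simp add: bij_betw_inv_into inj_imp_bij_betw_inv)
    then show "bij_betw (b \<circ> inv x) (verts (range x, map_prod x x ` R)) (verts \<Gamma>)"
      using b bij_betw_trans by fastforce
    fix u v assume "u \<in> verts (range x, map_prod x x ` R)" "v \<in> verts (range x, map_prod x x ` R)"
    then obtain i j where "u = x i" "v = x j"
      by auto
    then show "((u, v) \<in> edges (range x, map_prod x x ` R)) =
        (((b \<circ> inv x) u, (b \<circ> inv x) v) \<in> edges \<Gamma>)"
      using x(2) by (auto simp: R_def inj_eq)
  qed
  then have "{f. idempotent_endomorphism D f \<and> im D f = (range x, map_prod x x ` R)} \<subseteq>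
      {f. idempotent_endomorphism D f \<and> im D f \<cong> \<Gamma>}"
    by auto
  ultimately show ?thesis
    using lepoll_trans subset_imp_lepoll by blast
qed

theorem theorem4p4:
  fixes \<Gamma> :: "'a dgraph" and D :: "'b dgraph"
  assumes "directed_graph \<Gamma>" and "countable (verts \<Gamma>)"
    and "fraisse_limit finite_directed_graphs D"
  shows "((\<exists>f. idempotent_endomorphism D f \<and> im D f \<cong> \<Gamma>) \<longleftrightarrow> algebraically_closed \<Gamma>) \<and>
    (algebraically_closed \<Gamma> \<longrightarrow>
      {f. idempotent_endomorphism D f \<and> im D f \<cong> \<Gamma>} \<approx> (UNIV :: nat set set))"
proof (intro conjI iffI impI)
  assume "\<exists>f. idempotent_endomorphism D f \<and> im D f \<cong> \<Gamma>"
  then obtain f where "idempotent_endomorphism D f" "im D f \<cong> \<Gamma>"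
    by blast
  then show "algebraically_closed \<Gamma>"
    using algebraically_closed_isomorphic[of "im D f" \<Gamma>] algebraically_closed_im[of D f]
      algebraically_closed_fraisse_limit[OF assms(3)] by simp
next
  assume "algebraically_closed \<Gamma>"
  \<comment> \<open>Any value of the injection witnessing the lower bound is such an
    idempotent.\<close>
  from nat_set_lepoll_idempotents[OF assms(1,2) this assms(3)]
  show "\<exists>f. idempotent_endomorphism D f \<and> im D f \<cong> \<Gamma>"
    by (auto simp: lepoll_def)
next
  assume "algebraically_closed \<Gamma>"
  have "{f. idempotent_endomorphism D f \<and> im D f \<cong> \<Gamma>} \<subseteq> {f. endomorphism D f}"
    by (auto simp: idempotent_endomorphism_def)
  then have "{f. idempotent_endomorphism D f \<and> im D f \<cong> \<Gamma>} \<lesssim> (UNIV :: nat set set)"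
    using endomorphisms_lepoll_nat_set[of D] assms(3) lepoll_trans subset_imp_lepoll
    unfolding fraisse_limit_def by blast
  then show "{f. idempotent_endomorphism D f \<and> im D f \<cong> \<Gamma>} \<approx> (UNIV :: nat set set)"
    using nat_set_lepoll_idempotents[OF assms(1,2) \<open>algebraically_closed \<Gamma>\<close> assms(3)]
    by (rule lepoll_antisym)
qed

end
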